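(* Let $G$ be a countable group, and suppose that $G=S_0>S_1>S_2>\cdots$ is a strictly descending chain of subgroups satisfying the following two conditions. (1) For every $i\ge0$, the set of subgroups between $S_i$ and $G$ is exactly $\{K\mid S_i\le K\le G\}=\{S_i,S_{i-1},\ldots,S_0\}$. (2) For every $i\ge0$, the subgroup $S_{i+1}$ contains no nontrivial normal subgroup of $S_i$. Then there exists a strictly descending chain $G=H_0>H_1>H_2>\cdots$ of subgroups such that: (1) for every $i\ge0$, $H_i$ is conjugate to $S_i$ (in $G$); in particular $H_i\cong S_i$; (2) for every $i\ge0$, the set of subgroups between $H_i$ and $G$ is exactly $\{K\mid H_i\le K\le G\}=\{H_i,H_{i-1},\ldots,H_0\}$; (3) $\bigcap_{i\ge0}H_i=\{1\}$.
   Context: All notation is standard. In condition (2), "contains no nontrivial normal subgroup of $S_i$" means that there is no subgroup $N\ne\{1\}$ with $N\le S_{i+1}$ and $N$ normal in $S_i$. *)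

theory Defs
  imports "HOL-Algebra.Algebra" "HOL-Library.Countable_Set"
begin

definition strictly_descending_chain ::
    "('a, 'b) monoid_scheme \<Rightarrow> (nat \<Rightarrow> 'a set) \<Rightarrow> bool" where
  "strictly_descending_chain G S \<longleftrightarrow>
     S 0 = carrier G \<and> (\<forall>i. subgroup (S i) G) \<and> (\<forall>i. S (Suc i) \<subset> S i)"

definition intermediate_subgroups ::
    "('a, 'b) monoid_scheme \<Rightarrow> 'a set \<Rightarrow> 'a set set" where
  "intermediate_subgroups G H = {K. subgroup K G \<and> H \<subseteq> K}"

definition conjugate_subgroups ::
    "('a, 'b) monoid_scheme \<Rightarrow> 'a set \<Rightarrow> 'a set \<Rightarrow> bool" where
  "conjugate_subgroups G H K \<longleftrightarrow>
     subgroup H G \<and> subgroup K G \<and>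
     (\<exists>g\<in>carrier G. H = g <#\<^bsub>G\<^esub> (K #>\<^bsub>G\<^esub> inv\<^bsub>G\<^esub> g))"

end

theory Submission
  imports Defs
begin

text \<open>
  Conjugates \<open>H\<^sub>i = g\<^sub>i S\<^sub>i g\<^sub>i\<inverse>\<close> form a descending chain with the same interval structure as soon as
  \<open>g\<^sub>i\<^sub>+\<^sub>1 = g\<^sub>i s\<^sub>i\<close> with \<open>s\<^sub>i \<in> S\<^sub>i\<close>. The core of \<open>S\<^sub>i\<^sub>+\<^sub>1\<close> in \<open>S\<^sub>i\<close> is a normal subgroup of \<open>S\<^sub>i\<close> inside
  \<open>S\<^sub>i\<^sub>+\<^sub>1\<close>, hence trivial, so \<open>s\<^sub>i\<close> can be chosen to expel from \<open>H\<^sub>i\<^sub>+\<^sub>1\<close> the \<open>i\<close>-th element of an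
  enumeration of \<open>G\<close>, unless that element is \<open>1\<close>.
\<close>

text \<open>The body is literally the term inside \<open>conjugate_subgroups\<close>, so the final
  conjugacy claim holds by unfolding.\<close>

definition conjugate_set :: "('a, 'b) monoid_scheme \<Rightarrow> 'a \<Rightarrow> 'a set \<Rightarrow> 'a set" where
  "conjugate_set G g K = g <#\<^bsub>G\<^esub> (K #>\<^bsub>G\<^esub> inv\<^bsub>G\<^esub> g)"

context group
begin

lemma inv_mult_cancel:
  assumes "g \<in> carrier G" "x \<in> carrier G"
  shows "g \<otimes> (inv g \<otimes> x) = x" "inv g \<otimes> (g \<otimes> x) = x"
  using assms by (simp_all flip: m_assoc)

text \<open>Replaces the nested cosets by a membership test, which reduces later facts to
  cancellation in the group. The operation is unspecified off the carrier, hence the separate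
  conjunct \<open>x \<in> carrier G\<close>.\<close>

lemma mem_conjugate_set_iff:
  assumes "g \<in> carrier G" "K \<subseteq> carrier G"
  shows "x \<in> conjugate_set G g K \<longleftrightarrow> x \<in> carrier G \<and> inv g \<otimes> x \<otimes> g \<in> K"
proof
  assume "x \<in> conjugate_set G g K"
  then obtain k where k: "k \<in> K" and x: "x = g \<otimes> (k \<otimes> inv g)"
    by (auto simp: conjugate_set_def l_coset_def r_coset_def)
  have kc: "k \<in> carrier G" using k assms by auto
  have "inv g \<otimes> x \<otimes> g = k"
    using assms(1) kc by (simp add: x m_assoc inv_mult_cancel)
  then show "x \<in> carrier G \<and> inv g \<otimes> x \<otimes> g \<in> K"
    using k kc x assms by simp
next
  assume x: "x \<in> carrier G \<and> inv g \<otimes> x \<otimes> g \<in> K"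
  have "x = g \<otimes> (inv g \<otimes> x \<otimes> g \<otimes> inv g)"
    using assms(1) x by (simp add: m_assoc inv_mult_cancel)
  with x show "x \<in> conjugate_set G g K"
    unfolding conjugate_set_def l_coset_def r_coset_def by blast
qed

lemma conjugate_set_closed:
  "g \<in> carrier G \<Longrightarrow> K \<subseteq> carrier G \<Longrightarrow> conjugate_set G g K \<subseteq> carrier G"
  by (auto simp: mem_conjugate_set_iff)

lemma conjugate_set_mono:
  assumes "g \<in> carrier G" "L \<subseteq> carrier G" "K \<subseteq> L"
  shows "conjugate_set G g K \<subseteq> conjugate_set G g L"
  using assms by (auto simp: mem_conjugate_set_iff)

lemma conjugate_set_mult:
  assumes "g \<in> carrier G" "h \<in> carrier G" "K \<subseteq> carrier G"
  shows "conjugate_set G (g \<otimes> h) K = conjugate_set G g (conjugate_set G h K)"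
  using assms by (auto simp: mem_conjugate_set_iff conjugate_set_closed inv_mult_group m_assoc)

lemma conjugate_set_one: "K \<subseteq> carrier G \<Longrightarrow> conjugate_set G \<one> K = K"
  by (auto simp: mem_conjugate_set_iff subset_iff)

lemma conjugate_set_inv_cancel:
  assumes "g \<in> carrier G" "K \<subseteq> carrier G"
  shows "conjugate_set G (inv g) (conjugate_set G g K) = K"
    and "conjugate_set G g (conjugate_set G (inv g) K) = K"
  using assms by (simp_all flip: conjugate_set_mult add: conjugate_set_one)

lemma conjugate_set_self:
  assumes "subgroup K G" "h \<in> K"
  shows "conjugate_set G h K = K"
proof -
  interpret K: subgroup K G by fact
  have h: "h \<in> carrier G" using assms by auto
  have sub: "conjugate_set G k K \<subseteq> K" if "k \<in> K" for k
    using that by (auto simp: conjugate_set_def l_coset_def r_coset_def)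
  \<comment> \<open>The easy inclusion \<open>sub\<close>, used for \<open>inv h\<close> and then
    conjugated by \<open>h\<close>, yields the reverse inclusion.\<close>
  have "conjugate_set G h (conjugate_set G (inv h) K) \<subseteq> conjugate_set G h K"
    using sub[of "inv h"] assms h by (intro conjugate_set_mono) auto
  then have "K \<subseteq> conjugate_set G h K"
    using h by (simp add: conjugate_set_inv_cancel K.subset)
  with sub[OF assms(2)] show ?thesis by blast
qed

lemma subgroup_conjugate_set:
  assumes "g \<in> carrier G" "subgroup K G"
  shows "subgroup (conjugate_set G g K) G"
proof -
  interpret K: subgroup K G by fact
  note mem = mem_conjugate_set_iff[OF assms(1) K.subset]
  show ?thesis
  proof (rule subgroupI)
    show "conjugate_set G g K \<noteq> {}"
      using assms(1) mem[of \<one>] by auto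
  next
    fix x assume "x \<in> conjugate_set G g K"
    then have x: "x \<in> carrier G" "inv g \<otimes> x \<otimes> g \<in> K" by (auto simp: mem)
    have "inv (inv g \<otimes> x \<otimes> g) \<in> K" using x by blast
    then show "inv x \<in> conjugate_set G g K"
      using x assms(1) by (simp add: mem inv_mult_group m_assoc)
  next
    fix x y assume "x \<in> conjugate_set G g K" "y \<in> conjugate_set G g K"
    then have xy: "x \<in> carrier G" "inv g \<otimes> x \<otimes> g \<in> K" "y \<in> carrier G" "inv g \<otimes> y \<otimes> g \<in> K"
      by (auto simp: mem)
    have "(inv g \<otimes> x \<otimes> g) \<otimes> (inv g \<otimes> y \<otimes> g) = inv g \<otimes> (x \<otimes> y) \<otimes> g"
      using xy assms(1) by (simp add: m_assoc inv_mult_cancel)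
    moreover have "(inv g \<otimes> x \<otimes> g) \<otimes> (inv g \<otimes> y \<otimes> g) \<in> K" using xy by blast
    ultimately show "x \<otimes> y \<in> conjugate_set G g K"
      using xy by (simp add: mem)
  qed (use assms(1) in \<open>auto simp: mem\<close>)
qed

lemma conjugate_set_iso:
  assumes "g \<in> carrier G" "K \<subseteq> carrier G"
  shows "G\<lparr>carrier := conjugate_set G g K\<rparr> \<cong> G\<lparr>carrier := K\<rparr>"
proof -
  note mem = mem_conjugate_set_iff[OF assms]
  let ?f = "\<lambda>x. inv g \<otimes> x \<otimes> g"
  have "bij_betw ?f (conjugate_set G g K) K"
  proof (rule bij_betw_byWitness[where f' = "\<lambda>x. g \<otimes> x \<otimes> inv g"])
    show "\<forall>x\<in>conjugate_set G g K. g \<otimes> ?f x \<otimes> inv g = x"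
      using assms by (auto simp: mem m_assoc inv_mult_cancel)
    show "\<forall>k\<in>K. ?f (g \<otimes> k \<otimes> inv g) = k"
      using assms by (auto simp: m_assoc inv_mult_cancel dest: subsetD)
    show "?f ` conjugate_set G g K \<subseteq> K" by (auto simp: mem)
    show "(\<lambda>x. g \<otimes> x \<otimes> inv g) ` K \<subseteq> conjugate_set G g K"
      using assms by (force simp: conjugate_set_def l_coset_def r_coset_def m_assoc)
  qed
  moreover have "?f (x \<otimes> y) = ?f x \<otimes> ?f y" if "x \<in> carrier G" "y \<in> carrier G" for x y
    using that assms by (simp add: m_assoc inv_mult_cancel)
  ultimately have "?f \<in> iso (G\<lparr>carrier := conjugate_set G g K\<rparr>) (G\<lparr>carrier := K\<rparr>)"
    by (auto simp: iso_def hom_def mem)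
  then show ?thesis by (auto simp: is_iso_def)
qed

text \<open>The intersection is the normal core of \<open>L\<close> in \<open>K\<close>. Conjugation
  by \<open>x\<close> in \<open>K\<close> only permutes the conjugates:
  \<open>x \<otimes> h \<otimes> inv x\<close> lies in the one for \<open>s\<close> as soon as
  \<open>h\<close> lies in the one for \<open>inv x \<otimes> s\<close>, again an element of
  \<open>K\<close>.\<close>

lemma core_normal:
  assumes "subgroup K G" "subgroup L G" "L \<subseteq> K"
  shows "(\<Inter>s\<in>K. conjugate_set G s L) \<lhd> G\<lparr>carrier := K\<rparr>" (is "?N \<lhd> ?K")
proof -
  interpret K: subgroup K G by fact
  interpret L: subgroup L G by fact
  interpret KG: group ?K using assms(1) by (rule subgroup.subgroup_is_group) (rule is_group)
  have one: "\<one> \<in> K" by simp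
  have N: "subgroup ?N G"
  proof (rule subgroups_Inter)
    show "subgroup M G" if "M \<in> (\<lambda>s. conjugate_set G s L) ` K" for M
      using that subgroup_conjugate_set[OF _ assms(2)] by auto
  qed (use one in blast)
  have "?N \<subseteq> L" using one conjugate_set_one[OF L.subset] by blast
  then have "?N \<subseteq> K" using assms(3) by blast
  then have NK: "subgroup ?N ?K"
    using N assms(1) by (simp add: subgroup_incl)
  have "x \<otimes> h \<otimes> inv x \<in> ?N" if x: "x \<in> K" and h: "h \<in> ?N" for x h
  proof
    fix s assume s: "s \<in> K"
    have c: "s \<in> carrier G" "x \<in> carrier G" "h \<in> carrier G"
      using s x h N by (auto dest: subgroup.mem_carrier)
    have "inv x \<otimes> s \<in> K" using s x by blast
    then have "h \<in> conjugate_set G (inv x \<otimes> s) L" using h by blast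
    then show "x \<otimes> h \<otimes> inv x \<in> conjugate_set G s L"
      using c by (simp add: mem_conjugate_set_iff L.subset inv_mult_group m_assoc)
  qed
  then show ?thesis
    using NK assms(1) by (simp add: KG.normal_inv_iff m_inv_consistent)
qed

text \<open>Conjugation by \<open>g\<close> permutes the subgroups of \<open>G\<close>, preserves
  inclusion, and is undone by conjugation by \<open>inv g\<close>; so it carries the interval above
  \<open>K\<close> onto the interval above its conjugate.\<close>

lemma intermediate_subgroups_conjugate_set:
  assumes "g \<in> carrier G" "subgroup K G"
  shows "intermediate_subgroups G (conjugate_set G g K) = conjugate_set G g ` intermediate_subgroups G K"
proof (intro equalityI subsetI)
  fix L assume "L \<in> intermediate_subgroups G (conjugate_set G g K)"
  then have L: "subgroup L G" "conjugate_set G g K \<subseteq> L"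
    by (auto simp: intermediate_subgroups_def)
  have "conjugate_set G (inv g) (conjugate_set G g K) \<subseteq> conjugate_set G (inv g) L"
    using assms L by (intro conjugate_set_mono) (auto dest: subgroup.subset)
  then have "conjugate_set G (inv g) L \<in> intermediate_subgroups G K"
    using assms L by (simp add: intermediate_subgroups_def conjugate_set_inv_cancel subgroup.subset
        subgroup_conjugate_set)
  moreover have "L = conjugate_set G g (conjugate_set G (inv g) L)"
    using assms L by (simp add: conjugate_set_inv_cancel subgroup.subset)
  ultimately show "L \<in> conjugate_set G g ` intermediate_subgroups G K" by blast
next
  fix L assume "L \<in> conjugate_set G g ` intermediate_subgroups G K"
  then show "L \<in> intermediate_subgroups G (conjugate_set G g K)"
    using assms by (auto simp: intermediate_subgroups_def subgroup_conjugate_set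
        dest: conjugate_set_mono[OF assms(1) subgroup.subset, THEN subsetD])
qed

text \<open>Here \<open>g\<close> is the conjugator reached so far and \<open>s\<close> its
  correction. If every \<open>s\<close> failed, \<open>inv g \<otimes> a \<otimes> g\<close> would
  lie in the core of \<open>L\<close> in \<open>K\<close>, which \<open>core\<close> makes trivial,
  and \<open>a\<close> would be \<open>\<one>\<close>.\<close>

lemma ex_conjugate_avoiding:
  assumes K: "subgroup K G" and L: "subgroup L G" and "L \<subseteq> K"
    and core: "\<And>N. N \<lhd> G\<lparr>carrier := K\<rparr> \<Longrightarrow> N \<subseteq> L \<Longrightarrow> N = {\<one>}"
    and g: "g \<in> carrier G" and a: "a \<in> carrier G" "a \<noteq> \<one>"
  shows "\<exists>s\<in>K. a \<notin> conjugate_set G (g \<otimes> s) L"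
proof (rule ccontr)
  let ?N = "\<Inter>s\<in>K. conjugate_set G s L"
  assume "\<not> ?thesis"
  then have "inv g \<otimes> a \<otimes> g \<in> conjugate_set G s L" if "s \<in> K" for s
    using that a g subgroup.mem_carrier[OF K that] subgroup.subset[OF L]
    by (auto simp: mem_conjugate_set_iff conjugate_set_closed conjugate_set_mult)
  then have "inv g \<otimes> a \<otimes> g \<in> ?N" by blast
  moreover have "?N \<subseteq> L"
    using subgroup.one_closed[OF K] conjugate_set_one[OF subgroup.subset[OF L]] by blast
  then have "?N = {\<one>}"
    using core core_normal[OF K L \<open>L \<subseteq> K\<close>] by blast
  ultimately have "inv g \<otimes> a \<otimes> g = \<one>" by blast
  then have "a \<in> conjugate_set G g {\<one>}"
    using a g by (simp add: mem_conjugate_set_iff)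
  then show False
    using a g by (simp add: conjugate_set_def l_coset_def r_coset_def)
qed

end

theorem proposition7p29:
  fixes G :: "('a, 'b) monoid_scheme" (structure)
    and S :: "nat \<Rightarrow> 'a set"
  assumes "group G"
    and "countable (carrier G)"
    and "strictly_descending_chain G S"
    and "\<And>i. intermediate_subgroups G (S i) = {S j | j. j \<le> i}"
    and "\<And>i N. N \<lhd> G\<lparr>carrier := S i\<rparr> \<Longrightarrow> N \<subseteq> S (Suc i) \<Longrightarrow> N = {\<one>}"
  shows "\<exists>H. strictly_descending_chain G H \<and>
           (\<forall>i. conjugate_subgroups G (H i) (S i) \<and>
                G\<lparr>carrier := H i\<rparr> \<cong> G\<lparr>carrier := S i\<rparr>) \<and>
           (\<forall>i. intermediate_subgroups G (H i) = {H j | j. j \<le> i}) \<and>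
           (\<Inter>i. H i) = {\<one>}"
proof -
  interpret group G by fact
  have S0: "S 0 = carrier G" and sub: "\<And>i. subgroup (S i) G" and less: "\<And>i. S (Suc i) \<subset> S i"
    using assms(3) by (auto simp: strictly_descending_chain_def)
  note Sc = subgroup.subset[OF sub]
  \<comment> \<open>The enumeration stays in the carrier because the carrier is nonempty, and
    exhausts it by countability.\<close>
  define a where "a = from_nat_into (carrier G)"
  have a: "a i \<in> carrier G" for i
    unfolding a_def by (rule from_nat_into) auto
  have a_surj: "\<exists>i. a i = x" if "x \<in> carrier G" for x
    using from_nat_into_surj[OF assms(2) that] by (simp add: a_def)
  \<comment> \<open>The guard is unavoidable: \<open>\<one>\<close> lies in every conjugate of a
    subgroup.\<close>
  let ?step = "\<lambda>i g g'. \<exists>s\<in>S i. g' = g \<otimes> s \<and> (a i \<noteq> \<one> \<longrightarrow> a i \<notin> conjugate_set G g' (S (Suc i)))"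
  have "\<exists>g. \<forall>i. g i \<in> carrier G \<and> ?step i (g i) (g (Suc i))"
  proof (rule dependent_nat_choice)
    \<comment> \<open>Any starting element will do, since \<open>S 0\<close> is the whole group and
      every conjugation fixes it.\<close>
    show "\<exists>g. g \<in> carrier G" by blast
  next
    fix g i assume g: "g \<in> carrier G"
    have "\<exists>s\<in>S i. a i \<noteq> \<one> \<longrightarrow> a i \<notin> conjugate_set G (g \<otimes> s) (S (Suc i))"
    proof (cases "a i = \<one>")
      case True
      then show ?thesis using subgroup.one_closed[OF sub] by blast
    next
      case False
      then show ?thesis
        using ex_conjugate_avoiding[OF sub sub psubset_imp_subset[OF less] _ g a, of i i] assms(5)[of _ i]
        by blast
    qed
    then obtain s where "s \<in> S i" "a i \<noteq> \<one> \<longrightarrow> a i \<notin> conjugate_set G (g \<otimes> s) (S (Suc i))"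
      by blast
    then show "\<exists>g'. g' \<in> carrier G \<and> ?step i g g'"
      using g Sc by (intro exI[of _ "g \<otimes> s"]) auto
  qed
  then obtain g where g: "\<And>i. g i \<in> carrier G" and step: "\<And>i. ?step i (g i) (g (Suc i))"
    by blast
  define H where "H i = conjugate_set G (g i) (S i)" for i
  have H_sub: "subgroup (H i) G" for i
    unfolding H_def using g sub by (rule subgroup_conjugate_set)
  \<comment> \<open>The corrections made from stage \<open>j\<close> on lie in subgroups of
    \<open>S j\<close>, so they fix \<open>S j\<close> under conjugation. Hence the single element
    \<open>g i\<close> conjugates the whole segment \<open>S 0, ..., S i\<close> to
    \<open>H 0, ..., H i\<close>, which transports both the chain and its intervals.\<close>
  have conj_eq: "conjugate_set G (g i) (S j) = H j" if "j \<le> i" for i j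
    using that
  proof (induction i rule: dec_induct)
    case base
    show ?case by (simp add: H_def)
  next
    case (step i)
    obtain s where s: "s \<in> S i" "g (Suc i) = g i \<otimes> s" using \<open>?step i (g i) (g (Suc i))\<close> by blast
    have "S i \<subseteq> S j"
      using lift_Suc_antimono_le[of S j i] less step.hyps by blast
    then have "s \<in> S j" using s by blast
    then show ?case
      using s(2) g step.IH subgroup.mem_carrier[OF sub]
      by (simp add: conjugate_set_mult Sc conjugate_set_self[OF sub])
  qed
  have "H (Suc i) \<subset> H i" for i
  proof -
    have sub_i: "H (Suc i) \<subseteq> H i"
      using conjugate_set_mono[OF g Sc psubset_imp_subset[OF less], of "Suc i" i] conj_eq[of i "Suc i"]
      by (simp add: H_def)
    moreover have "H (Suc i) \<noteq> H i"
    proof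
      assume "H (Suc i) = H i"
      \<comment> \<open>Both sides are now conjugates by the same element, which can be
        cancelled.\<close>
      then have "conjugate_set G (g (Suc i)) (S (Suc i)) = conjugate_set G (g (Suc i)) (S i)"
        using conj_eq[of i "Suc i"] by (simp add: H_def)
      then have "S (Suc i) = S i"
        using conjugate_set_inv_cancel(1)[OF g Sc] by metis
      then show False using less[of i] by blast
    qed
    ultimately show ?thesis by blast
  qed
  moreover have "H 0 = carrier G"
    using conjugate_set_self[OF sub[of 0]] g S0 by (simp add: H_def)
  ultimately have "strictly_descending_chain G H"
    using H_sub by (simp add: strictly_descending_chain_def)
  moreover have "conjugate_subgroups G (H i) (S i)" for i
    using H_sub sub g by (auto simp: conjugate_subgroups_def H_def conjugate_set_def)
  moreover have "G\<lparr>carrier := H i\<rparr> \<cong> G\<lparr>carrier := S i\<rparr>" for i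
    unfolding H_def using g Sc by (rule conjugate_set_iso)
  moreover have "intermediate_subgroups G (H i) = {H j | j. j \<le> i}" for i
  proof -
    have "intermediate_subgroups G (H i) = conjugate_set G (g i) ` {S j | j. j \<le> i}"
      unfolding H_def using intermediate_subgroups_conjugate_set[OF g sub] assms(4) by simp
    also have "\<dots> = {conjugate_set G (g i) (S j) | j. j \<le> i}" by blast
    also have "\<dots> = {H j | j. j \<le> i}" using conj_eq by metis
    finally show ?thesis .
  qed
  moreover have "(\<Inter>i. H i) = {\<one>}"
  proof
    show "{\<one>} \<subseteq> (\<Inter>i. H i)" using subgroup.one_closed[OF H_sub] by blast
    show "(\<Inter>i. H i) \<subseteq> {\<one>}"
    proof
      fix x assume x: "x \<in> (\<Inter>i. H i)"
      then have "x \<in> carrier G" using subgroup.mem_carrier[OF H_sub] by blast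
      then obtain i where i: "a i = x" using a_surj by blast
      \<comment> \<open>Index shift: \<open>a i\<close> is expelled at \<open>H (Suc i)\<close>, as
        \<open>H 0\<close> is all of \<open>G\<close>. A nontrivial \<open>x\<close> thus misses
        some term of the chain.\<close>
      have "a i \<noteq> \<one> \<longrightarrow> a i \<notin> H (Suc i)" using step[of i] unfolding H_def by blast
      then show "x \<in> {\<one>}" using i x by blast
    qed
  qed
  ultimately show ?thesis by blast
qed

end
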